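(* Let $(X,\mathcal{F},\tau_\ast)$ be a complete Menger space such that $\alpha\ast\alpha\ge\alpha$ for all $\alpha\in[0,1]$. Let $x_0\in X$, $r\in(0,1)$, $t>0$, and let $\overline{S_t}(x_0,r,\mathcal{F})=\{x\in X: F_{x,x_0}(t)\ge 1-r\}$. Let $f:X\to X$ be a probabilistic TSR P-contraction mapping on $\overline{S_t}(x_0,r,\mathcal{F})$ with contraction constant less than or equal to $\frac12$; that is, for every $u>0$ there exists $k\in(0,\frac12]$ such that $$1-F_{f(x),f(y)}(k^{m+1}u)\le k\bigl(1-F_{x,y}(k^m u)\bigr)\quad\text{for all }x,y\in \overline{S_t}(x_0,r,\mathcal{F})\text{ and all }m\in\mathbb{N}=\{0,1,2,\dots\}.$$ Suppose that $\overline{S_t}(x_0,r,\mathcal{F})$ is t-closed and that $F_{x_0,f(x_0)}(u)>1-r$ for all $u>0$. Then $f$ has a unique fixed point in $\overline{S_t}(x_0,r,\mathcal{F})$.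
   Context: A t-norm is a binary operation $\ast$ on $[0,1]$ that is commutative, associative, non-decreasing in each argument, and satisfies $x\ast 1=x$. A distance distribution function is a non-decreasing function $F:[-\infty,\infty]\to[0,1]$, left continuous on $\mathbb{R}$, with $F(-\infty)=0$, $F(\infty)=1$, $F(0)=0$; the set of these is $\Delta^+$. $H_0\in\Delta^+$ is given by $H_0(u)=0$ for $u\le 0$ and $H_0(u)=1$ for $u>0$. A triangle function is a binary operation $\tau$ on $\Delta^+$ that is commutative, associative, non-decreasing in each place (pointwise order), with identity $H_0$. A probabilistic metric space (PM space) is a triple $(X,\mathcal{F},\tau)$ with $X$ a nonempty set, $\tau$ a triangle function, and $\mathcal{F}:X\times X\to\Delta^+$, $(p,q)\mapsto F_{p,q}$, such that for all $p,q,r\in X$: (i) $F_{p,q}=H_0$ iff $p=q$; (ii) $F_{p,q}=F_{q,p}$; (iii) $F_{p,r}\ge\tau(F_{p,q},F_{q,r})$. A Menger space $(X,\mathcal{F},\tau_\ast)$ is a PM space whose triangle function is $\tau_\ast$, where for a t-norm $\ast$, $\tau_\ast(F,G)(t)=\sup\{F(t_1)\ast G(t_2): t_1+t_2=t,\ t_1,t_2\ge 0\}$ for $t\ge 0$. A sequence $\{x_n\}$ in $X$ converges to $x\in X$ if for all $\alpha\in(0,1)$ and $t>0$ there is a natural number $m$ with $F_{x_n,x}(t)>1-\alpha$ for all $n\ge m$. It is a Cauchy sequence if for all $\alpha\in(0,1)$ and $t>0$ there is a natural number $m$ with $F_{x_{n+p},x_n}(t)>1-\alpha$ for all $n\ge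 m$ and all natural numbers $p$. The space is complete if every Cauchy sequence converges to a point of $X$. For fixed $t>0$, $a\in X$ and $\rho\in(0,1)$, the t-open sphere is $S_t(a,\rho,\mathcal{F})=\{x\in X:F_{x,a}(t)>1-\rho\}$. A point $a\in X$ is a t-limit point of $S\subseteq X$ if for every $\rho\in(0,1)$ the set $S_t(a,\rho,\mathcal{F})$ intersects $S$. A subset $S\subseteq X$ is t-closed if it contains all its t-limit points. In the hypothesis that $\overline{S_t}(x_0,r,\mathcal{F})$ is t-closed, $t$ is the same number as in the sphere. The contraction constant $k$ may depend on $u$ but not on $x,y,m$. *)

theory Defs
  imports Complex_Main "HOL-Library.Extended_Real" "HOL-Library.FuncSet"
begin

text \<open>
  Distribution functions are rendered as functions \<^typ>\<open>ereal \<Rightarrow> real\<close>; a triangle function is an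
  operation on this type whose axioms are relativised to the carrier \<open>Delta_plus\<close>.  Likewise, a
  t-norm is a function on the reals whose axioms are relativised to the unit interval.
\<close>

definition t_norm :: "(real \<Rightarrow> real \<Rightarrow> real) \<Rightarrow> bool" where
  "t_norm T \<longleftrightarrow>
     (\<forall>x\<in>{0..1}. \<forall>y\<in>{0..1}. T x y \<in> {0..1}) \<and>
     (\<forall>x\<in>{0..1}. \<forall>y\<in>{0..1}. T x y = T y x) \<and>
     (\<forall>x\<in>{0..1}. \<forall>y\<in>{0..1}. \<forall>z\<in>{0..1}. T (T x y) z = T x (T y z)) \<and>
     (\<forall>x\<in>{0..1}. \<forall>x'\<in>{0..1}. \<forall>y\<in>{0..1}. \<forall>y'\<in>{0..1}.
        x \<le> x' \<longrightarrow> y \<le> y' \<longrightarrow> T x y \<le> T x' y') \<and>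
     (\<forall>x\<in>{0..1}. T x 1 = x)"

definition Delta_plus :: "(ereal \<Rightarrow> real) set" where
  "Delta_plus = {F. range F \<subseteq> {0..1} \<and> mono F \<and>
     (\<forall>x::real. continuous (at_left (ereal x)) F) \<and>
     F (-\<infinity>) = 0 \<and> F \<infinity> = 1 \<and> F 0 = 0}"

definition H0 :: "ereal \<Rightarrow> real" where
  "H0 u = (if u \<le> 0 then 0 else 1)"

text \<open>The order on distribution functions is the pointwise order of the function type.\<close>

definition triangle_function :: "((ereal \<Rightarrow> real) \<Rightarrow> (ereal \<Rightarrow> real) \<Rightarrow> (ereal \<Rightarrow> real)) \<Rightarrow> bool" where
  "triangle_function \<tau> \<longleftrightarrow>
     (\<forall>F\<in>Delta_plus. \<forall>G\<in>Delta_plus. \<tau> F G \<in> Delta_plus) \<and>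
     (\<forall>F\<in>Delta_plus. \<forall>G\<in>Delta_plus. \<tau> F G = \<tau> G F) \<and>
     (\<forall>F\<in>Delta_plus. \<forall>G\<in>Delta_plus. \<forall>H\<in>Delta_plus. \<tau> (\<tau> F G) H = \<tau> F (\<tau> G H)) \<and>
     (\<forall>F\<in>Delta_plus. \<forall>F'\<in>Delta_plus. \<forall>G\<in>Delta_plus. \<forall>G'\<in>Delta_plus.
        F \<le> F' \<longrightarrow> G \<le> G' \<longrightarrow> \<tau> F G \<le> \<tau> F' G') \<and>
     (\<forall>F\<in>Delta_plus. \<tau> F H0 = F)"

definition pm_space ::
  "'a set \<Rightarrow> ('a \<Rightarrow> 'a \<Rightarrow> ereal \<Rightarrow> real) \<Rightarrow>
   ((ereal \<Rightarrow> real) \<Rightarrow> (ereal \<Rightarrow> real) \<Rightarrow> (ereal \<Rightarrow> real)) \<Rightarrow> bool" where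
  "pm_space X F \<tau> \<longleftrightarrow> X \<noteq> {} \<and> triangle_function \<tau> \<and>
     (\<forall>p\<in>X. \<forall>q\<in>X. F p q \<in> Delta_plus) \<and>
     (\<forall>p\<in>X. \<forall>q\<in>X. F p q = H0 \<longleftrightarrow> p = q) \<and>
     (\<forall>p\<in>X. \<forall>q\<in>X. F p q = F q p) \<and>
     (\<forall>p\<in>X. \<forall>q\<in>X. \<forall>r\<in>X. \<tau> (F p q) (F q r) \<le> F p r)"

text \<open>
  The supremum formula is for \<open>t \<ge> 0\<close>; the value for negative \<open>t\<close> is \<open>0\<close>, which is forced by
  membership in \<^const>\<open>Delta_plus\<close>.
\<close>

definition tau_of ::
  "(real \<Rightarrow> real \<Rightarrow> real) \<Rightarrow> (ereal \<Rightarrow> real) \<Rightarrow> (ereal \<Rightarrow> real) \<Rightarrow> ereal \<Rightarrow> real" where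
  "tau_of T F G t =
     (if t < 0 then 0
      else Sup {T (F t1) (G t2) | t1 t2. t1 + t2 = t \<and> 0 \<le> t1 \<and> 0 \<le> t2})"

text \<open>
  For a general t-norm the operation \<^const>\<open>tau_of\<close> need not preserve left continuity; that it is a
  triangle function is part of \<^const>\<open>pm_space\<close>.
\<close>

definition menger_space ::
  "'a set \<Rightarrow> ('a \<Rightarrow> 'a \<Rightarrow> ereal \<Rightarrow> real) \<Rightarrow> (real \<Rightarrow> real \<Rightarrow> real) \<Rightarrow> bool" where
  "menger_space X F T \<longleftrightarrow> t_norm T \<and> pm_space X F (tau_of T)"

definition pm_converges :: "('a \<Rightarrow> 'a \<Rightarrow> ereal \<Rightarrow> real) \<Rightarrow> (nat \<Rightarrow> 'a) \<Rightarrow> 'a \<Rightarrow> bool" where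
  "pm_converges F s x \<longleftrightarrow>
     (\<forall>\<alpha>::real\<in>{0<..<1}. \<forall>t::real>0. \<exists>m. \<forall>n\<ge>m. F (s n) x (ereal t) > 1 - \<alpha>)"

definition pm_Cauchy :: "('a \<Rightarrow> 'a \<Rightarrow> ereal \<Rightarrow> real) \<Rightarrow> (nat \<Rightarrow> 'a) \<Rightarrow> bool" where
  "pm_Cauchy F s \<longleftrightarrow>
     (\<forall>\<alpha>::real\<in>{0<..<1}. \<forall>t::real>0. \<exists>m. \<forall>n\<ge>m. \<forall>p. F (s (n + p)) (s n) (ereal t) > 1 - \<alpha>)"

definition pm_complete :: "'a set \<Rightarrow> ('a \<Rightarrow> 'a \<Rightarrow> ereal \<Rightarrow> real) \<Rightarrow> bool" where
  "pm_complete X F \<longleftrightarrow>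
     (\<forall>s. range s \<subseteq> X \<longrightarrow> pm_Cauchy F s \<longrightarrow> (\<exists>x\<in>X. pm_converges F s x))"

definition t_open_sphere ::
  "'a set \<Rightarrow> ('a \<Rightarrow> 'a \<Rightarrow> ereal \<Rightarrow> real) \<Rightarrow> real \<Rightarrow> 'a \<Rightarrow> real \<Rightarrow> 'a set" where
  "t_open_sphere X F t a \<rho> = {x\<in>X. F x a (ereal t) > 1 - \<rho>}"

definition t_closed_sphere ::
  "'a set \<Rightarrow> ('a \<Rightarrow> 'a \<Rightarrow> ereal \<Rightarrow> real) \<Rightarrow> real \<Rightarrow> 'a \<Rightarrow> real \<Rightarrow> 'a set" where
  "t_closed_sphere X F t a \<rho> = {x\<in>X. F x a (ereal t) \<ge> 1 - \<rho>}"

text \<open>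
  As in the source, the sphere is not punctured, so every point of \<open>S\<close> is a t-limit point of \<open>S\<close>.
\<close>

definition t_limit_point ::
  "'a set \<Rightarrow> ('a \<Rightarrow> 'a \<Rightarrow> ereal \<Rightarrow> real) \<Rightarrow> real \<Rightarrow> 'a \<Rightarrow> 'a set \<Rightarrow> bool" where
  "t_limit_point X F t a S \<longleftrightarrow>
     a \<in> X \<and> (\<forall>\<rho>\<in>{0<..<1}. t_open_sphere X F t a \<rho> \<inter> S \<noteq> {})"

definition t_closed ::
  "'a set \<Rightarrow> ('a \<Rightarrow> 'a \<Rightarrow> ereal \<Rightarrow> real) \<Rightarrow> real \<Rightarrow> 'a set \<Rightarrow> bool" where
  "t_closed X F t S \<longleftrightarrow> S \<subseteq> X \<and> (\<forall>a. t_limit_point X F t a S \<longrightarrow> a \<in> S)"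

text \<open>
  The contraction constant \<open>k\<close>, bounded by \<open>c\<close>, may depend on \<open>u\<close>, but not on \<open>x\<close>, \<open>y\<close>, \<open>m\<close>.
\<close>

definition tsr_P_contraction_on ::
  "('a \<Rightarrow> 'a \<Rightarrow> ereal \<Rightarrow> real) \<Rightarrow> ('a \<Rightarrow> 'a) \<Rightarrow> 'a set \<Rightarrow> real \<Rightarrow> bool" where
  "tsr_P_contraction_on F f S c \<longleftrightarrow>
     (\<forall>u::real>0. \<exists>k::real. 0 < k \<and> k \<le> c \<and>
        (\<forall>x\<in>S. \<forall>y\<in>S. \<forall>m::nat.
           1 - F (f x) (f y) (ereal (k ^ (m + 1) * u)) \<le> k * (1 - F x y (ereal (k ^ m * u)))))"

end

theory Submission
  imports Defs
begin

text \<open>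
  A t-norm with \<open>T \<alpha> \<alpha> \<ge> \<alpha>\<close> dominates the minimum, so the triangle inequality reads
  \<open>F p s (a + b) \<ge> min (F p q a) (F q s b)\<close>.  Taking \<open>m = 0\<close> in the contraction property and using
  monotonicity of \<open>F\<close>, one gets \<open>1 - F (f x) (f y) u \<le> (1 - F x y u) / 2\<close> for every \<open>u > 0\<close>, at the
  same scale \<open>u\<close>.  As the hypothesis on \<open>F x0 (f x0)\<close> holds at all scales, the orbit of \<open>x0\<close>
  satisfies \<open>F (f^n x0) (f^(n+p) x0) u \<ge> 1 - r / 2^n\<close> for all \<open>u > 0\<close>: the scale lost at each use of
  the triangle inequality is harmless.  Hence the orbit stays in the closed sphere and is Cauchy;
  its limit is the fixed point.
\<close>

lemma Delta_plus_range: "F \<in> Delta_plus \<Longrightarrow> F u \<in> {0..1}"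
  unfolding Delta_plus_def by blast

lemma Delta_plus_mono: "F \<in> Delta_plus \<Longrightarrow> u \<le> v \<Longrightarrow> F u \<le> F v"
  unfolding Delta_plus_def by (auto dest: monoD)

text \<open>This turns bounds at all positive scales into equality of points. Monotonicity and
  \<open>F 0 = 0\<close> settle \<open>u \<le> 0\<close>; the range bound settles
  \<open>u > 0\<close>, with \<open>F \<infinity> = 1\<close> covering the infinite
  argument.\<close>

lemma Delta_plus_eq_H0:
  assumes F: "F \<in> Delta_plus" and one: "\<And>u::real. 0 < u \<Longrightarrow> 1 \<le> F (ereal u)"
  shows "F = H0"
proof
  fix u :: ereal
  have zero: "F 0 = 0" and inf: "F \<infinity> = 1"
    using F by (auto simp: Delta_plus_def)
  show "F u = H0 u"
  proof (cases "u \<le> 0")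
    case True
    then have "F u \<le> 0"
      using Delta_plus_mono[OF F True] zero by simp
    then show ?thesis
      using True Delta_plus_range[OF F, of u] by (simp add: H0_def)
  next
    case False
    then have "1 \<le> F u"
      using one inf by (cases u) auto
    then show ?thesis
      using False Delta_plus_range[OF F, of u] by (simp add: H0_def)
  qed
qed

text \<open>The supremum is taken in the reals, so a member lies below it only once the set is known
  to be bounded; the bound 1 comes from \<open>T\<close> mapping into the unit interval.\<close>

lemma tau_of_ge:
  assumes T: "t_norm T" and FG: "F \<in> Delta_plus" "G \<in> Delta_plus" and "0 \<le> a" "0 \<le> b"
  shows "T (F a) (G b) \<le> tau_of T F G (a + b)"
proof -
  let ?S = "{T (F t1) (G t2) | t1 t2. t1 + t2 = a + b \<and> 0 \<le> t1 \<and> 0 \<le> t2}"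
  have "T (F t1) (G t2) \<le> 1" for t1 t2
  proof -
    have "\<forall>x\<in>{0..1}. \<forall>y\<in>{0..1}. T x y \<in> {0..1}"
      using T unfolding t_norm_def by blast
    then show ?thesis
      using Delta_plus_range[OF FG(1), of t1] Delta_plus_range[OF FG(2), of t2]
      by (meson atLeastAtMost_iff)
  qed
  then have "bdd_above ?S"
    by (intro bdd_aboveI[of _ 1]) auto
  moreover have "T (F a) (G b) \<in> ?S"
    using assms(4,5) by blast
  ultimately have "T (F a) (G b) \<le> Sup ?S"
    by (rule cSup_upper[rotated])
  moreover have "\<not> a + b < 0"
    using assms(4,5) by (simp add: not_less)
  ultimately show ?thesis
    by (simp add: tau_of_def)
qed

text \<open>Lower both arguments to their minimum, where idempotence applies, and use
  monotonicity.\<close>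

lemma idempotent_t_norm_ge_min:
  assumes T: "t_norm T" and idem: "\<forall>\<alpha>\<in>{0..1}. T \<alpha> \<alpha> \<ge> \<alpha>"
    and "x \<in> {0..1}" "y \<in> {0..1}"
  shows "min x y \<le> T x y"
proof -
  have mono: "\<forall>x\<in>{0..1}. \<forall>x'\<in>{0..1}. \<forall>y\<in>{0..1}. \<forall>y'\<in>{0..1}.
      x \<le> x' \<longrightarrow> y \<le> y' \<longrightarrow> T x y \<le> T x' y'"
    using T unfolding t_norm_def by blast
  have m: "min x y \<in> {0..1}"
    using assms(3,4) by (auto simp: min_def)
  have "min x y \<le> T (min x y) (min x y)"
    using idem m by blast
  also have "\<dots> \<le> T x y"
    using mono m assms(3,4) by (meson min.cobounded1 min.cobounded2)
  finally show ?thesis .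
qed

lemma menger_idempotent_triangle:
  assumes M: "menger_space X F T" and idem: "\<forall>\<alpha>\<in>{0..1}. T \<alpha> \<alpha> \<ge> \<alpha>"
    and X: "p \<in> X" "q \<in> X" "s \<in> X"
    and "0 < u" and "c \<le> F p q (ereal (u/2))" "c \<le> F q s (ereal (u/2))"
  shows "c \<le> F p s (ereal u)"
proof -
  have T: "t_norm T" and D: "F p q \<in> Delta_plus" "F q s \<in> Delta_plus"
    and tri: "tau_of T (F p q) (F q s) \<le> F p s"
    using M X unfolding menger_space_def pm_space_def by auto
  have "c \<le> min (F p q (ereal (u/2))) (F q s (ereal (u/2)))"
    using assms by simp
  also have "\<dots> \<le> T (F p q (ereal (u/2))) (F q s (ereal (u/2)))"
    by (intro idempotent_t_norm_ge_min T idem Delta_plus_range D)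
  also have "\<dots> \<le> tau_of T (F p q) (F q s) (ereal (u/2) + ereal (u/2))"
    using \<open>0 < u\<close> by (intro tau_of_ge T D) auto
  also have "\<dots> \<le> F p s (ereal (u/2) + ereal (u/2))"
    using tri by (simp add: le_fun_def)
  finally show ?thesis
    by simp
qed

lemma tsr_P_contraction_on_same_scale:
  assumes con: "tsr_P_contraction_on F f S (1/2)"
    and "x \<in> S" "y \<in> S" and D: "F x y \<in> Delta_plus" "F (f x) (f y) \<in> Delta_plus"
    and "0 < u"
  shows "1 - F (f x) (f y) (ereal u) \<le> (1 - F x y (ereal u)) / 2"
proof -
  obtain k where k: "0 < k" "k \<le> 1/2"
    and *: "\<And>x y m. x \<in> S \<Longrightarrow> y \<in> S \<Longrightarrow>
      1 - F (f x) (f y) (ereal (k ^ (m + 1) * u)) \<le> k * (1 - F x y (ereal (k ^ m * u)))"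
    using con \<open>0 < u\<close> unfolding tsr_P_contraction_on_def by blast
  \<comment> \<open>The bound on \<open>k\<close> serves twice: \<open>k \<le> 1\<close> lets the
    scale grow from \<open>k * u\<close> back to \<open>u\<close>, and \<open>k \<le> 1/2\<close>
    bounds the factor. Thus \<open>k\<close>, which depends on \<open>u\<close>, disappears.\<close>
  have "k * u \<le> 1 * u"
    using k \<open>0 < u\<close> by (intro mult_right_mono) auto
  then have "F (f x) (f y) (ereal (k * u)) \<le> F (f x) (f y) (ereal u)"
    by (intro Delta_plus_mono D) simp
  then have "1 - F (f x) (f y) (ereal u) \<le> 1 - F (f x) (f y) (ereal (k * u))"
    by simp
  also have "\<dots> \<le> k * (1 - F x y (ereal u))"
    using *[OF assms(2,3), of 0] by simp
  also have "\<dots> \<le> (1/2) * (1 - F x y (ereal u))"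
    using k Delta_plus_range[OF D(1), of "ereal u"] by (intro mult_right_mono) auto
  finally show ?thesis
    by simp
qed

theorem theorem3p8:
  fixes X :: "'a set"
    and F :: "'a \<Rightarrow> 'a \<Rightarrow> ereal \<Rightarrow> real"
    and T :: "real \<Rightarrow> real \<Rightarrow> real"
    and f :: "'a \<Rightarrow> 'a"
    and x0 :: 'a
    and r t :: real
  assumes "menger_space X F T"
    and "pm_complete X F"
    and "\<forall>\<alpha>\<in>{0..1}. T \<alpha> \<alpha> \<ge> \<alpha>"
    and "x0 \<in> X"
    and "r \<in> {0<..<1}"
    and "t > 0"
    and "f \<in> X \<rightarrow> X"
    and "tsr_P_contraction_on F f (t_closed_sphere X F t x0 r) (1/2)"
    and "t_closed X F t (t_closed_sphere X F t x0 r)"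
    and "\<forall>u::real>0. F x0 (f x0) (ereal u) > 1 - r"
  shows "\<exists>!x. x \<in> t_closed_sphere X F t x0 r \<and> f x = x"
proof -
  define B where "B = t_closed_sphere X F t x0 r"
  define s where "s n = (f ^^ n) x0" for n
  have s_0: "s 0 = x0" and s_Suc: "f (s n) = s (Suc n)" for n
    by (simp_all add: s_def)
  have D: "F p q \<in> Delta_plus" and eq_H0: "F p q = H0 \<longleftrightarrow> p = q" and sym: "F p q = F q p"
    if "p \<in> X" "q \<in> X" for p q
    using assms(1) that unfolding menger_space_def pm_space_def by auto
  note tri = menger_idempotent_triangle[OF assms(1,3)]
  have fX: "f p \<in> X" if "p \<in> X" for p
    using assms(7) that by blast
  have BX: "p \<in> X" if "p \<in> B" for p
    using that by (simp add: B_def t_closed_sphere_def)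
  have contr: "1 - F (f p) (f q) (ereal u) \<le> (1 - F p q (ereal u)) / 2"
    if "p \<in> B" "q \<in> B" "0 < u" for p q u
    using assms(8) that BX fX D by (intro tsr_P_contraction_on_same_scale) (auto simp: B_def)
  have eqI: "p = q" if "p \<in> X" "q \<in> X" "\<And>u. 0 < u \<Longrightarrow> 1 \<le> F p q (ereal u)" for p q
    using Delta_plus_eq_H0[OF D] eq_H0 that by blast
  have refl: "F p p (ereal u) = 1" if "p \<in> X" "0 < u" for p u
    using eq_H0[of p p] that by (simp add: H0_def)
  have sX: "s n \<in> X" for n
    using assms(4) fX by (induction n) (auto simp: s_def)
  have r: "0 < r" "r < 1"
    using assms(5) by auto
  have in_B: "s n \<in> B" if "1 - r \<le> F x0 (s n) (ereal t)" for n
    using that sX sym[OF assms(4) sX] by (simp add: B_def t_closed_sphere_def)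

  \<comment> \<open>The two claims need each other: the first, at scale \<open>t\<close>, puts the
    orbit in \<open>B\<close> so that the contraction applies; the second supplies the next link for
    the first. Both range over all \<open>u\<close> because the triangle inequality halves the
    scale.\<close>
  have orbit: "(\<forall>u>0. 1 - r \<le> F x0 (s n) (ereal u)) \<and>
      (\<forall>u>0. 1 - r / 2 ^ n \<le> F (s n) (s (Suc n)) (ereal u))" for n
  proof (induction n)
    case 0
    have "s (Suc 0) = f x0"
      by (simp add: s_def)
    then show ?case
      using assms(10) refl[OF assms(4)] r by (auto simp: s_0 less_imp_le)
  next
    case (Suc n)
    have "1 - r \<le> 1 - r / 2 ^ n"
      using r by (simp add: field_simps)
    then have "1 - r \<le> F (s n) (s (Suc n)) (ereal (u/2))" if "0 < u" for u
      using Suc that order_trans half_gt_zero by blast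
    then have step: "1 - r \<le> F x0 (s (Suc n)) (ereal u)" if "0 < u" for u
      using Suc that by (intro tri[OF assms(4) sX[of n] sX that]) auto
    have "s n \<in> B" "s (Suc n) \<in> B"
      using Suc step assms(6) in_B by auto
    then have *: "1 - F (s (Suc n)) (s (Suc (Suc n))) (ereal u)
        \<le> (1 - F (s n) (s (Suc n)) (ereal u)) / 2" if "0 < u" for u
      using contr that s_Suc by metis
    have "1 - r / 2 ^ Suc n \<le> F (s (Suc n)) (s (Suc (Suc n))) (ereal u)" if "0 < u" for u
    proof -
      have "1 - F (s (Suc n)) (s (Suc (Suc n))) (ereal u)
          \<le> (1 - F (s n) (s (Suc n)) (ereal u)) / 2"
        using *[OF that] .
      also have "\<dots> \<le> (r / 2 ^ n) / 2"
        using Suc that by (intro divide_right_mono) (auto simp: algebra_simps)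
      also have "\<dots> = r / 2 ^ Suc n"
        by simp
      finally show ?thesis
        by (simp only: diff_le_eq add.commute)
    qed
    then show ?case
      using step by blast
  qed
  have sB: "s n \<in> B" for n
    using orbit assms(6) in_B by blast

  \<comment> \<open>Bounds combine by minimum rather than by addition, so the first link dominates
    and the estimate is independent of \<open>p\<close>.\<close>
  have far: "1 - r / 2 ^ n \<le> F (s n) (s (n + p)) (ereal u)" if "0 < u" for n p u
    using that
  proof (induction p arbitrary: u)
    case 0
    then show ?case
      using refl[OF sX] r by simp
  next
    case (Suc p)
    have "r / 2 ^ (n + p) \<le> r / 2 ^ n"
      using r by (intro divide_left_mono) auto
    moreover have "1 - r / 2 ^ (n + p) \<le> F (s (n + p)) (s (Suc (n + p))) (ereal (u/2))"
      using orbit[of "n + p"] Suc.prems by simp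
    ultimately have "1 - r / 2 ^ n \<le> F (s (n + p)) (s (n + Suc p)) (ereal (u/2))"
      by simp
    moreover have "1 - r / 2 ^ n \<le> F (s n) (s (n + p)) (ereal (u/2))"
      using Suc by simp
    ultimately show ?case
      using tri[OF sX sX sX] Suc.prems by blast
  qed
  have "pm_Cauchy F s"
    unfolding pm_Cauchy_def
  proof (intro ballI allI impI)
    fix \<alpha> u :: real
    assume \<alpha>: "\<alpha> \<in> {0<..<1}" and u: "0 < u"
    obtain m where m: "(1/2) ^ m < \<alpha>"
      using real_arch_pow_inv[of \<alpha> "1/2"] \<alpha> by auto
    have "1 - \<alpha> < F (s (n + p)) (s n) (ereal u)" if "m \<le> n" for n p
    proof -
      have "r / 2 ^ n \<le> 1 / 2 ^ n"
        using r by (intro divide_right_mono) auto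
      also have "\<dots> \<le> 1 / 2 ^ m"
        using that by (intro divide_left_mono power_increasing) auto
      also have "\<dots> < \<alpha>"
        using m by (simp add: power_one_over)
      finally show ?thesis
        using far[OF u, of n p] sym[OF sX sX, of n "n + p"] by simp
    qed
    then show "\<exists>m. \<forall>n\<ge>m. \<forall>p. 1 - \<alpha> < F (s (n + p)) (s n) (ereal u)"
      by blast
  qed
  then obtain x where x: "x \<in> X" and conv: "pm_converges F s x"
    using assms(2) sX unfolding pm_complete_def by blast
  have conv: "\<exists>m. \<forall>n\<ge>m. 1 - \<alpha> < F (s n) x (ereal u)" if "\<alpha> \<in> {0<..<1}" "0 < u" for \<alpha> u
    using conv that unfolding pm_converges_def by blast

  have "t_limit_point X F t x B"
    unfolding t_limit_point_def
  proof (intro conjI ballI x)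
    fix \<rho> :: real
    assume "\<rho> \<in> {0<..<1}"
    then obtain n where "1 - \<rho> < F (s n) x (ereal t)"
      using conv assms(6) by blast
    then show "t_open_sphere X F t x \<rho> \<inter> B \<noteq> {}"
      using sX sB by (auto simp: t_open_sphere_def)
  qed
  then have xB: "x \<in> B"
    using assms(9) unfolding t_closed_def B_def by blast

  have "f x = x"
  proof (rule eqI[OF fX[OF x] x], rule ccontr)
    fix u :: real
    assume u: "0 < u" and "\<not> 1 \<le> F (f x) x (ereal u)"
    moreover have "0 \<le> F (f x) x (ereal u)"
      using Delta_plus_range[OF D[OF fX[OF x] x]] by simp
    \<comment> \<open>halved so that \<open>\<alpha> < 1\<close> even when the value of \<open>F\<close> is \<open>0\<close>\<close>
    moreover define \<alpha> where "\<alpha> = (1 - F (f x) x (ereal u)) / 2"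
    ultimately have \<alpha>: "\<alpha> \<in> {0<..<1}" and less: "F (f x) x (ereal u) < 1 - \<alpha>"
      by auto
    \<comment> \<open>A single index makes both \<open>s n\<close> and its image
      \<open>s (Suc n)\<close> close to \<open>x\<close>; the triangle inequality from
      \<open>f x\<close> to \<open>x\<close> then passes through \<open>s (Suc n)\<close>.\<close>
    obtain n where n: "1 - \<alpha> < F (s n) x (ereal (u/2))" "1 - \<alpha> < F (s (Suc n)) x (ereal (u/2))"
      using conv[OF \<alpha>, of "u/2"] u by (meson half_gt_zero le_SucI order_refl)
    have "1 - F (f x) (s (Suc n)) (ereal (u/2)) \<le> (1 - F (s n) x (ereal (u/2))) / 2"
      using contr[OF xB sB[of n], of "u/2"] u sym[OF x sX[of n]] by (simp add: s_Suc)
    then have "1 - \<alpha> \<le> F (f x) (s (Suc n)) (ereal (u/2))"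
      using n(1) \<alpha> by auto
    then have "1 - \<alpha> \<le> F (f x) x (ereal u)"
      using tri[OF fX[OF x] sX x u] n(2) by simp
    with less show False
      by simp
  qed
  \<comment> \<open>For two fixed points the contraction gives
    \<open>1 - F y x u \<le> (1 - F y x u) / 2\<close>, which forces
    \<open>F y x u \<ge> 1\<close>.\<close>
  moreover have "y = x" if "y \<in> B" "f y = y" for y
  proof (rule eqI[OF BX[OF that(1)] x])
    fix u :: real
    assume "0 < u"
    then show "1 \<le> F y x (ereal u)"
      using contr[OF that(1) xB] that(2) \<open>f x = x\<close> by fastforce
  qed
  ultimately show ?thesis
    using xB unfolding B_def by blast
qed

end
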